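(* For every integer $n\ge 1$, $$c_n=(-1)^n(2n+1)!!\,\det(A_n),$$ where $A_n$ is the $n\times n$ matrix with entries, for $1\le i,j\le n$, $$(A_n)_{ij}=\begin{cases}\dfrac{1}{i+j}, & j-i\le 1,\\ 0, & \text{otherwise.}\end{cases}$$
   Context: $(2n+1)!!=1\cdot 3\cdot 5\cdots(2n+1)$. Let $\mathcal H=L^2([0,1],dx)$ (complex-valued functions, Lebesgue measure) with its norm $\|\cdot\|$. The sequence $(c_n)_{n\ge 0}$ is defined recursively: $c_0=1$, and, writing $p_n(x)=c_0+c_1x+\ldots+c_nx^n$, for each $n\ge 0$ the number $c_{n+1}$ is the unique complex number $c$ for which the norm $\|p_n(x)+c\,x^{n+1}\|$ is minimal among all $c\in\mathbb C$. Equivalently, $c_0=1$ and $\frac{c_0}{n+1}+\frac{c_1}{n+2}+\ldots+\frac{c_n}{2n+1}=0$ for all $n\ge 1$. *)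

theory Defs
  imports "HOL-Analysis.Analysis" "Jordan_Normal_Form.Determinant"
begin

text \<open>The norm of $L^2([0,1],dx)$. It is only ever applied to polynomial functions, which are
  square integrable, so the value given to non-integrable functions plays no role.\<close>

definition L2_norm01 :: "(real \<Rightarrow> complex) \<Rightarrow> real" where
  "L2_norm01 f = sqrt (LINT x|lebesgue_on {0..1}. (cmod (f x))\<^sup>2)"

fun c_seq :: "nat \<Rightarrow> complex" where
  "c_seq 0 = 1"
| "c_seq (Suc n) = (THE z. is_arg_min
      (\<lambda>z. L2_norm01 (\<lambda>x. (\<Sum>k\<le>n. c_seq k * of_real x ^ k) + z * of_real x ^ (n + 1)))
      (\<lambda>_. True) z)"

text \<open>\<open>odd_double_fact n\<close> is $(2n+1)!!$, not $n!!$.\<close>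

definition odd_double_fact :: "nat \<Rightarrow> nat" where
  "odd_double_fact n = (\<Prod>k\<le>n. 2 * k + 1)"

text \<open>Rows and columns of \<open>mat\<close> are numbered from 0; the mathematical row and column numbers are
  \<open>i + 1\<close> and \<open>j + 1\<close>. The condition $j-i\le 1$ is stated on integers, as natural subtraction
  truncates.\<close>

definition A_mat :: "nat \<Rightarrow> complex mat" where
  "A_mat n = mat n n (\<lambda>(i, j).
     if int (j + 1) - int (i + 1) \<le> 1 then 1 / of_nat ((i + 1) + (j + 1)) else 0)"

end

theory Submission
  imports Defs
begin

text \<open>Minimality of the norm means orthogonality, so that \<open>\<Sum>k\<le>n. c\<^sub>k / (k + n + 1) = 0\<close> for \<open>n \<ge> 1\<close>.
  The first \<open>n\<close> of these equations say that \<open>A\<^sub>n\<close> maps \<open>(c\<^sub>0, \<dots>, c\<^sub>n\<^sub>-\<^sub>1)\<close> to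
  \<open>- c\<^sub>n / (2n + 1)\<close> times the last unit vector. Since \<open>c\<^sub>0 = 1\<close>, Cramer's rule for the first
  unknown expresses \<open>det A\<^sub>n\<close> through the minor of \<open>A\<^sub>n\<close> without the last row and the first column,
  which is lower triangular with diagonal \<open>1/3, 1/5, \<dots>, 1/(2n - 1)\<close>.\<close>

declare c_seq.simps(2) [simp del]

lemma integral_power_lebesgue_on_01:
  "(LINT x|lebesgue_on {0..1}. x ^ k) = 1 / (real k + 1)"
proof -
  have "((\<lambda>x::real. x ^ k) has_integral 1 ^ Suc k / real (Suc k) - 0 ^ Suc k / real (Suc k)) {0..1}"
  proof (rule fundamental_theorem_of_calculus)
    fix x :: real
    have "((\<lambda>x. x ^ Suc k / real (Suc k)) has_real_derivative x ^ k) (at x within {0..1})"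
      by (rule derivative_eq_intros refl | simp)+
    then show "((\<lambda>x. x ^ Suc k / real (Suc k)) has_vector_derivative x ^ k) (at x within {0..1})"
      by (simp add: has_real_derivative_iff_has_vector_derivative)
  qed simp
  moreover have "integrable (lebesgue_on {0..1}) (\<lambda>x::real. x ^ k)"
    by (intro continuous_imp_integrable_real continuous_intros)
  ultimately show ?thesis
    by (simp add: lebesgue_integral_eq_integral integral_unique add.commute)
qed

text \<open>Since \<open>x ^ k * x ^ m\<close> integrates over \<open>{0..1}\<close> to
  \<open>1 / (k + m + 1)\<close>, the hypothesis says that the sum is orthogonal to
  \<open>x ^ m\<close>. So the cross term vanishes and \<open>w * x ^ m\<close> only adds its own
  squared norm.\<close>

lemma L2_norm01_pythagoras:
  fixes a :: "nat \<Rightarrow> complex"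
  assumes orth: "(\<Sum>k\<le>m. a k / of_nat (k + m + 1)) = 0"
  shows "L2_norm01 (\<lambda>x. (\<Sum>k\<le>m. a k * of_real x ^ k) + w * of_real x ^ m)
    = sqrt ((LINT x|lebesgue_on {0..1}. (cmod (\<Sum>k\<le>m. a k * of_real x ^ k))\<^sup>2)
        + (cmod w)\<^sup>2 / (2 * real m + 1))"
proof -
  let ?L = "lebesgue_on {0..1::real}"
  let ?q = "\<lambda>x::real. \<Sum>k\<le>m. a k * of_real x ^ k"
  have split: "(cmod (?q x + w * of_real x ^ m))\<^sup>2
      = (cmod (?q x))\<^sup>2 + (\<Sum>k\<le>m. 2 * Re (cnj w * a k) * x ^ (k + m)) + (cmod w)\<^sup>2 * x ^ (2 * m)" for x
  proof -
    have "(cmod (?q x + w * of_real x ^ m))\<^sup>2 = (cmod (?q x))\<^sup>2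
        + 2 * Re (cnj w * (?q x * of_real (x ^ m))) + (cmod w)\<^sup>2 * (x ^ m)\<^sup>2"
      by (simp only: cmod_power2 of_real_power [symmetric])
         (simp add: power2_eq_square algebra_simps)
    also have "cnj w * (?q x * of_real (x ^ m)) = (\<Sum>k\<le>m. of_real (x ^ (k + m)) * (cnj w * a k))"
      by (simp add: sum_distrib_left sum_distrib_right power_add mult_ac)
    also have "2 * Re \<dots> = (\<Sum>k\<le>m. 2 * Re (cnj w * a k) * x ^ (k + m))"
      unfolding Re_sum sum_distrib_left by (intro sum.cong refl) simp
    finally show ?thesis
      by (simp only: power_even_eq)
  qed
  have int_q: "integrable ?L (\<lambda>x. (cmod (?q x))\<^sup>2)"
    by (intro continuous_imp_integrable_real continuous_intros)
  have int_pow: "integrable ?L (\<lambda>x. x ^ k)" for k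
    by (intro continuous_imp_integrable_real continuous_intros)
  \<comment> \<open>The integrated cross terms are collected into the left side of
    \<open>orth\<close>.\<close>
  have "(\<Sum>k\<le>m. 2 * Re (cnj w * a k) * (1 / (real (k + m) + 1)))
      = 2 * Re (cnj w * (\<Sum>k\<le>m. a k / of_nat (k + m + 1)))"
    unfolding sum_distrib_left Re_sum
  proof (intro sum.cong refl)
    fix k
    have "cnj w * (a k / of_nat (k + m + 1)) = cnj w * a k / of_real (real (k + m) + 1)"
      by (simp add: add.commute)
    then show "2 * Re (cnj w * a k) * (1 / (real (k + m) + 1))
        = 2 * Re (cnj w * (a k / of_nat (k + m + 1)))"
      by (simp only: Re_divide_of_real) simp
  qed
  then have cross: "(\<Sum>k\<le>m. 2 * Re (cnj w * a k) * (1 / (real (k + m) + 1))) = 0"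
    by (simp only: orth) simp
  have "(LINT x|?L. (cmod (?q x + w * of_real x ^ m))\<^sup>2)
      = (LINT x|?L. (cmod (?q x))\<^sup>2) + (\<Sum>k\<le>m. 2 * Re (cnj w * a k) * (1 / (real (k + m) + 1)))
        + (cmod w)\<^sup>2 * (1 / (real (2 * m) + 1))"
    unfolding split
    by (simp only: Bochner_Integration.integral_add Bochner_Integration.integral_sum
        integral_mult_right_zero integral_power_lebesgue_on_01 int_q int_pow
        Bochner_Integration.integrable_add Bochner_Integration.integrable_sum
        integrable_mult_right)
  then show ?thesis
    unfolding L2_norm01_def cross by simp
qed

text \<open>The hypothesis makes the polynomial with top coefficient \<open>z0\<close> orthogonal to
  \<open>x ^ (n + 1)\<close>, so passing from \<open>z0\<close> to \<open>z\<close> raises the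
  squared norm by a positive multiple of \<open>(cmod (z - z0))\<^sup>2\<close>. Having an
  equivalence, not just minimality, is what evaluates the \<open>THE\<close> in
  \<open>c_seq\<close>.\<close>

lemma is_arg_min_L2_norm01_iff:
  fixes a :: "nat \<Rightarrow> complex"
  assumes orth: "(\<Sum>k\<le>n. a k / of_nat (k + n + 2)) + z0 / of_nat (2 * n + 3) = 0"
  shows "is_arg_min
    (\<lambda>z. L2_norm01 (\<lambda>x. (\<Sum>k\<le>n. a k * of_real x ^ k) + z * of_real x ^ (n + 1))) (\<lambda>_. True) z
    \<longleftrightarrow> z = z0"
proof -
  \<comment> \<open>With \<open>z0\<close> absorbed as the coefficient at \<open>Suc n\<close>, the
    Pythagorean identity applies with \<open>m = Suc n\<close> and
    \<open>w = z - z0\<close>.\<close>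
  define b where "b = a(Suc n := z0)"
  let ?I = "LINT x|lebesgue_on {0..1}. (cmod (\<Sum>k\<le>Suc n. b k * of_real x ^ k))\<^sup>2"
  have b_sum: "(\<Sum>k\<le>Suc n. b k * f k) = (\<Sum>k\<le>n. a k * f k) + z0 * f (Suc n)"
    for f :: "nat \<Rightarrow> complex"
    by (auto simp: b_def intro!: sum.cong)
  have "(\<Sum>k\<le>Suc n. b k / of_nat (k + Suc n + 1)) = 0"
    using orth b_sum [of "\<lambda>k. 1 / of_nat (k + Suc n + 1)"]
    by (simp add: algebra_simps numeral_3_eq_3)
  note pyth = L2_norm01_pythagoras [OF this]
  have norm_eq: "L2_norm01 (\<lambda>x. (\<Sum>k\<le>n. a k * of_real x ^ k) + z * of_real x ^ (n + 1))
      = sqrt (?I + (cmod (z - z0))\<^sup>2 / (2 * real (Suc n) + 1))" for z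
  proof -
    have "(\<lambda>x. (\<Sum>k\<le>n. a k * of_real x ^ k) + z * of_real x ^ (n + 1))
        = (\<lambda>x. (\<Sum>k\<le>Suc n. b k * of_real x ^ k) + (z - z0) * of_real x ^ Suc n)"
      unfolding b_sum by (simp add: algebra_simps)
    then show ?thesis
      by (simp only: pyth)
  qed
  have pos: "0 < 2 * real (Suc n) + 1"
    by simp
  show ?thesis
  proof
    assume "is_arg_min
      (\<lambda>z. L2_norm01 (\<lambda>x. (\<Sum>k\<le>n. a k * of_real x ^ k) + z * of_real x ^ (n + 1))) (\<lambda>_. True) z"
    \<comment> \<open>The competitor \<open>z0\<close> has norm \<open>sqrt ?I\<close>.\<close>
    then have "\<not> ?I < ?I + (cmod (z - z0))\<^sup>2 / (2 * real (Suc n) + 1)"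
      unfolding norm_eq is_arg_min_def by (auto dest: spec [of _ z0])
    then have "\<not> 0 < (cmod (z - z0))\<^sup>2 / (2 * real (Suc n) + 1)"
      by linarith
    then show "z = z0"
      using pos by (simp add: zero_less_divide_iff)
  next
    assume "z = z0"
    then show "is_arg_min
      (\<lambda>z. L2_norm01 (\<lambda>x. (\<Sum>k\<le>n. a k * of_real x ^ k) + z * of_real x ^ (n + 1))) (\<lambda>_. True) z"
      unfolding norm_eq is_arg_min_def by (auto simp: not_less)
  qed
qed

lemma smult_one_mat_mult_vec:
  fixes v :: "'a::comm_ring_1 Matrix.vec"
  assumes "v \<in> carrier_vec n"
  shows "(d \<cdot>\<^sub>m 1\<^sub>m n) *\<^sub>v v = d \<cdot>\<^sub>v v"
proof (rule eq_vecI)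
  fix i assume "i < dim_vec (d \<cdot>\<^sub>v v)"
  then show "((d \<cdot>\<^sub>m 1\<^sub>m n) *\<^sub>v v) $ i = (d \<cdot>\<^sub>v v) $ i"
    using assms by simp
qed (use assms in auto)

lemma c_seq_orthogonality:
  assumes "n \<ge> 1"
  shows "(\<Sum>k\<le>n. c_seq k / of_nat (k + n + 1)) = 0"
proof -
  obtain m where n: "n = Suc m"
    using assms by (cases n) auto
  \<comment> \<open>The orthogonality condition is linear in the new coefficient; this is its
    solution.\<close>
  define z0 where "z0 = - (of_nat (2 * m + 3) * (\<Sum>k\<le>m. c_seq k / of_nat (k + m + 2)))"
  have "of_nat (2 * m + 3) \<noteq> (0::complex)"
    by (simp only: of_nat_eq_0_iff)
  then have orth: "(\<Sum>k\<le>m. c_seq k / of_nat (k + m + 2)) + z0 / of_nat (2 * m + 3) = 0"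
    unfolding z0_def by (simp del: of_nat_add of_nat_mult)
  have "c_seq (Suc m) = z0"
    unfolding c_seq.simps is_arg_min_L2_norm01_iff [OF orth] by simp
  with orth show ?thesis
    by (simp add: n algebra_simps numeral_3_eq_3)
qed

lemma dim_A_mat [simp]: "dim_row (A_mat n) = n" "dim_col (A_mat n) = n"
  by (simp_all add: A_mat_def)

lemma A_mat_mult_c_seq:
  assumes "n \<ge> 1"
  shows "A_mat n *\<^sub>v vec n c_seq = (- c_seq n / of_nat (2 * n + 1)) \<cdot>\<^sub>v unit_vec n (n - 1)"
proof (rule eq_vecI)
  fix i assume "i < dim_vec ((- c_seq n / of_nat (2 * n + 1)) \<cdot>\<^sub>v unit_vec n (n - 1))"
  then have i: "i < n"
    by simp
  let ?f = "\<lambda>k. c_seq k / of_nat (k + Suc i + 1)"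
  \<comment> \<open>Row \<open>i\<close>, counted from 0, carries the orthogonality relation for
    \<open>Suc i\<close>, cut off at column \<open>n - 1\<close>.\<close>
  have "(A_mat n *\<^sub>v vec n c_seq) $ i = (\<Sum>k<n. if k \<le> Suc i then ?f k else 0)"
    using i by (auto simp: A_mat_def scalar_prod_def lessThan_atLeast0 algebra_simps intro!: sum.cong)
  also have "\<dots> = (\<Sum>k\<in>{..<n} \<inter> {..Suc i}. ?f k)"
    by (simp only: sum.inter_restrict finite_lessThan atMost_iff)
  also have "\<dots> = (if i = n - 1 then - c_seq n / of_nat (2 * n + 1) else 0)"
  proof (cases "i = n - 1")
    case True
    then have Suc_i: "Suc i = n"
      using assms by simp
    have lessThan: "{..<n} \<inter> {..n} = {..<n}"
      by auto
    \<comment> \<open>In the last row the relation has one term more than there are columns; that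
      term moves to the right side.\<close>
    have "(\<Sum>k<n. c_seq k / of_nat (k + n + 1)) + c_seq n / of_nat (2 * n + 1) = 0"
      using c_seq_orthogonality [OF assms] unfolding lessThan_Suc_atMost [symmetric] sum.lessThan_Suc mult_2 .
    then have "(\<Sum>k<n. c_seq k / of_nat (k + n + 1)) = - c_seq n / of_nat (2 * n + 1)"
      unfolding minus_divide_left [symmetric] by (rule eq_neg_iff_add_eq_0 [THEN iffD2])
    then show ?thesis
      unfolding Suc_i lessThan if_P [OF True] .
  next
    case False
    \<comment> \<open>Here the whole relation for \<open>Suc i\<close> fits into the row.\<close>
    then have "{..<n} \<inter> {..Suc i} = {..Suc i}"
      using i by auto
    then show ?thesis
      using False c_seq_orthogonality [of "Suc i"] by simp
  qed
  finally show "(A_mat n *\<^sub>v vec n c_seq) $ i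
      = ((- c_seq n / of_nat (2 * n + 1)) \<cdot>\<^sub>v unit_vec n (n - 1)) $ i"
    using i assms by (simp add: unit_vec_def)
qed (simp add: A_mat_def)

text \<open>Removing the first column shifts the column index by one, so the superdiagonal of
  \<open>A_mat (Suc m)\<close>, beyond which all entries vanish, becomes the diagonal of the
  minor.\<close>

lemma det_A_mat_minor:
  "Determinant.det (mat_delete (A_mat (Suc m)) m 0) = 1 / of_nat (\<Prod>i<m. 2 * i + 3)"
proof -
  let ?M = "mat_delete (A_mat (Suc m)) m 0"
  have M: "?M \<in> carrier_mat m m"
    by (simp add: A_mat_def mat_delete_def)
  have entry: "?M $$ (i, j) = (if j \<le> i then 1 / of_nat (i + j + 3) else 0)"
    if "i < m" "j < m" for i j
    using that by (simp add: mat_delete_def A_mat_def numeral_3_eq_3)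
  have "Determinant.det ?M = prod_list (diag_mat ?M)"
    by (rule det_lower_triangular [OF _ M]) (simp add: entry)
  also have "\<dots> = (\<Prod>i<m. ?M $$ (i, i))"
    by (simp only: prod_list_diag_prod mat_delete_dim dim_A_mat diff_Suc_1 lessThan_atLeast0 [of m])
  also have "\<dots> = (\<Prod>i<m. 1 / of_nat (2 * i + 3))"
    by (intro prod.cong) (simp_all add: entry flip: mult_2)
  also have "\<dots> = 1 / of_nat (\<Prod>i<m. 2 * i + 3)"
    by (simp only: prod_dividef of_nat_prod prod.neutral_const)
  finally show ?thesis .
qed

text \<open>The trivial factor 1 is dropped and the last factor split off: the product is the
  denominator of the minor, and \<open>2 * m + 3\<close> is the denominator in the last row's
  equation.\<close>

lemma odd_double_fact_Suc:
  "odd_double_fact (Suc m) = (\<Prod>i<m. 2 * i + 3) * (2 * m + 3)"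
proof -
  have "odd_double_fact (Suc m) = (\<Prod>k<Suc m. 2 * Suc k + 1)"
    unfolding odd_double_fact_def lessThan_Suc_atMost [symmetric]
    by (subst prod.lessThan_Suc_shift) simp
  also have "\<dots> = (\<Prod>k<Suc m. 2 * k + 3)"
    by (rule prod.cong) simp_all
  finally show ?thesis
    by (simp only: prod.lessThan_Suc)
qed

theorem mainTheorem5:
  fixes n :: nat
  assumes "n \<ge> 1"
  shows "c_seq n = (-1) ^ n * of_nat (odd_double_fact n) * Determinant.det (A_mat n)"
proof -
  obtain m where n: "n = Suc m"
    using assms by (cases n) auto
  let ?A = "A_mat n" and ?c = "vec n c_seq"
  let ?P = "of_nat (\<Prod>i<m. 2 * i + 3) :: complex" and ?d = "of_nat (2 * m + 3) :: complex"
  have A: "?A \<in> carrier_mat n n"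
    by (simp add: A_mat_def)
  \<comment> \<open>The normalisation \<open>c_seq 0 = 1\<close> enters here.\<close>
  have "Determinant.det ?A = (Determinant.det ?A \<cdot>\<^sub>v ?c) $ 0"
    by (simp add: n)
  also have "Determinant.det ?A \<cdot>\<^sub>v ?c = (adj_mat ?A * ?A) *\<^sub>v ?c"
    unfolding adj_mat(3) [OF A] by (rule smult_one_mat_mult_vec [symmetric]) simp
  also have "\<dots> = adj_mat ?A *\<^sub>v (?A *\<^sub>v ?c)"
    by (rule assoc_mult_mat_vec [OF adj_mat(1) [OF A] A]) simp
  \<comment> \<open>The last unit vector selects the entry of the adjugate in row 0 and column
    \<open>m\<close>; by transposition it is the cofactor at \<open>(m, 0)\<close>.\<close>
  also have "\<dots> $ 0 = (- c_seq n / ?d) * cofactor ?A m 0"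
    unfolding A_mat_mult_c_seq [OF assms] using A
    by (simp add: n adj_mat_def scalar_prod_def unit_vec_def if_distrib add.commute cong: if_cong)
  also have "cofactor ?A m 0 = (-1) ^ m / ?P"
    using det_A_mat_minor [of m] by (simp add: cofactor_def n)
  finally have det: "Determinant.det ?A = (- c_seq n / ?d) * ((-1) ^ m / ?P)" .
  have nz: "?P \<noteq> 0" "?d \<noteq> 0"
    by (simp_all only: of_nat_eq_0_iff) simp_all
  have sq: "(-1) ^ m * (-1) ^ m = (1::complex)"
    by (metis power_mult_distrib mult_minus1 minus_minus power_one)
  \<comment> \<open>Used with \<open>e = (-1) ^ m\<close>, so that \<open>- e\<close> is the sign
    \<open>(-1) ^ n\<close> and \<open>p * d\<close> is the double factorial.\<close>
  have cancel: "c = (- e) * (p * d) * ((- c / d) * (e / p))"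
    if "p \<noteq> 0" "d \<noteq> 0" "e * e = 1" for c p d e :: complex
  proof -
    have "(- e) * (p * d) * ((- c / d) * (e / p)) = (e * e) * c"
      using that(1,2) by (simp add: field_simps)
    then show ?thesis
      using that(3) by simp
  qed
  have "(-1) ^ n = - ((-1) ^ m :: complex)"
    by (simp add: n)
  moreover have "of_nat (odd_double_fact n) = ?P * ?d"
    by (simp only: n odd_double_fact_Suc of_nat_mult)
  ultimately show ?thesis
    using cancel [OF nz sq, of "c_seq n"] by (simp only: det)
qed

end
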